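(* For every integer $n \geq 4$, the inequality $p_{n+2}^2 < p_{n+1}^2 + p_n^2$ holds, where $p_n$ denotes the $n$th prime number.
   Context: The primes are indexed in increasing order starting from $n=1$: $p_1 = 2$, $p_2 = 3$, $p_3 = 5$, $p_4 = 7$, and so on. *)

theory Defs
  imports Complex_Main "HOL-Library.Infinite_Set" "HOL-Computational_Algebra.Primes"
begin

(* The enumeration of an infinite set of naturals starts at 0, whereas primes are
   indexed from 1 here; the value at index 0 is irrelevant. *)
definition nth_prime :: "nat \<Rightarrow> nat" where
  "nth_prime n = enumerate {p::nat. prime p} (n - 1)"

lemma nth_prime_1: "nth_prime 1 = 2"
  unfolding nth_prime_def
  by (auto simp: enumerate_0 intro!: Least_equality dest: prime_ge_2_nat)

lemma nth_prime_Suc: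
  assumes "n \<ge> 1"
  shows "nth_prime (Suc n) = (LEAST p. prime p \<and> nth_prime n < p)"
proof -
  obtain m where "n = Suc m" using assms by (cases n) auto
  then show ?thesis
    by (simp add: nth_prime_def enumerate_Suc'' primes_infinite)
qed

end

theory Submission
  imports Defs "HOL-Number_Theory.Prime_Powers" "HOL-Analysis.Complex_Transcendental"
begin

text \<open>
  It suffices that every interval \<open>(x, 7x/5]\<close> with \<open>x \<ge> 23\<close> contains two primes, because
  \<open>(7/5)\<^sup>2 < 2\<close>. For large \<open>x\<close> this is Chebyshev's argument: with \<open>T n = ln n!\<close>, the combination
  \<open>T(n) - T(n/2) - T(n/3) - T(n/5) + T(n/30)\<close> is \<open>An + O(ln n)\<close> with \<open>A \<approx> 0.921\<close>, and it lies
  between \<open>\<psi>(n) - \<psi>(n/6)\<close> and \<open>\<psi>(n)\<close>. Hence \<open>\<psi>\<close> is between \<open>An\<close> and \<open>6An/5\<close> up to lower order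
  terms, and \<open>7/5\<close> exceeds \<open>6/5\<close>. Prime powers contribute little: each prime has at most one power
  in \<open>(x, 2x]\<close>. Below \<open>4096\<close> an explicit chain of primes is used.
\<close>

section \<open>Logarithms of factorials\<close>

text \<open>This is the integral of \<open>ln\<close> from 1 to \<open>x\<close>. Its argument is
  real so that \<open>n / d\<close> can be inserted without rounding.\<close>

definition stirling_main :: "real \<Rightarrow> real" where
  "stirling_main x = x * ln x - x + 1"

text \<open>After cancellation this is \<open>ln t \<le> t - 1\<close> at \<open>t = b / a\<close>.
  Neither order of \<open>a\<close> and \<open>b\<close> is assumed, so swapping them gives the
  lower bound as well.\<close>

lemma stirling_main_diff_le:
  assumes "0 < a" "0 < b"
  shows "stirling_main b - stirling_main a \<le> (b - a) * ln b"
proof -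
  have "a * (ln b - ln a) \<le> a * (b / a - 1)"
    using assms ln_le_minus_one[of "b / a"] by (intro mult_left_mono) (auto simp: ln_div)
  also have "\<dots> = b - a" using assms by (simp add: field_simps)
  finally show ?thesis by (simp add: stirling_main_def algebra_simps)
qed

lemma stirling_main_diff_ge:
  assumes "0 < a" "0 < b"
  shows "(b - a) * ln a \<le> stirling_main b - stirling_main a"
  using stirling_main_diff_le[OF assms(2,1)] by (simp add: algebra_simps)

lemma ln_fact_bounds:
  assumes "n \<ge> 1"
  shows "stirling_main n \<le> ln (fact n)" "ln (fact n) \<le> stirling_main n + ln n"
proof -
  have "stirling_main n \<le> ln (fact n) \<and> ln (fact n) \<le> stirling_main n + ln n"
    using assms
  proof (induction n rule: dec_induct)
    case base
    show ?case by (simp add: stirling_main_def)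
  next
    case (step n)
    have "ln (fact (Suc n)) = ln (real (Suc n)) + ln (fact n)"
      by (simp add: ln_mult add.commute del: of_nat_Suc)
    moreover have "stirling_main (Suc n) - stirling_main n \<le> ln (Suc n)"
      using stirling_main_diff_le[of "real n" "real (Suc n)"] step by simp
    moreover have "ln n \<le> stirling_main (Suc n) - stirling_main n"
      using stirling_main_diff_ge[of "real n" "real (Suc n)"] step by simp
    ultimately show ?case using step by linarith
  qed
  then show "stirling_main n \<le> ln (fact n)" "ln (fact n) \<le> stirling_main n + ln n" by auto
qed

text \<open>Rounding \<open>n / d\<close> down moves \<open>stirling_main\<close> by at most
  \<open>ln n\<close>. The summand 1 covers \<open>n < d\<close>, where the factorial is 1 and
  \<open>stirling_main (n / d)\<close> lies between 0 and 1.\<close>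

lemma ln_fact_div_approx:
  fixes n d :: nat
  assumes "n \<ge> 1" "d \<ge> 1"
  shows "\<bar>ln (fact (n div d)) - stirling_main (n / d)\<bar> \<le> 1 + ln n"
proof (cases "n div d = 0")
  case True
  then have "n < d" using assms by (simp add: div_eq_0_iff)
  define x where "x = real n / real d"
  have x: "0 < x" "x < 1" using assms \<open>n < d\<close> by (auto simp: x_def)
  have "stirling_main x \<le> 1"
    using x mult_nonneg_nonpos[of x "ln x"] unfolding stirling_main_def
    by (smt (verit) ln_le_zero_iff)
  moreover have "0 \<le> stirling_main x"
    using stirling_main_diff_ge[of 1 x] x by (simp add: stirling_main_def)
  moreover have "0 \<le> ln (real n)" using assms by simp
  ultimately show ?thesis using True by (simp add: x_def)
next
  case False
  define q where "q = n div d"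
  define x where "x = real n / real d"
  have q: "1 \<le> q" using False by (simp add: q_def)
  have "q * d \<le> n" "n < (q + 1) * d"
    using assms by (auto simp: q_def dividend_less_div_times add.commute)
  then have qx: "real q \<le> x" "x < real q + 1"
    using assms by (simp_all add: x_def field_simps flip: of_nat_mult of_nat_add)
  have "x \<le> n" using assms by (simp add: x_def field_simps)
  have x1: "1 \<le> x" using qx q by linarith
  have lnx: "0 \<le> ln x" "ln x \<le> ln n" using x1 \<open>x \<le> n\<close> by auto
  have "stirling_main x - stirling_main q \<le> (x - q) * ln x"
    using stirling_main_diff_le[of "real q" x] q x1 by simp
  also have "\<dots> \<le> 1 * ln x" using qx lnx by (intro mult_right_mono) auto
  finally have up: "stirling_main x - stirling_main q \<le> ln x" by simp
  have "0 \<le> (x - q) * ln (real q)" using qx q by (intro mult_nonneg_nonneg) auto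
  then have lo: "stirling_main q \<le> stirling_main x"
    using stirling_main_diff_ge[of "real q" x] q x1 by simp
  have "ln (real q) \<le> ln x" using q qx by simp
  then show ?thesis
    using ln_fact_bounds[OF q] up lo lnx unfolding q_def[symmetric] x_def[symmetric] by linarith
qed

text \<open>Legendre's formula in terms of the von Mangoldt function. The upper limit
  \<open>N\<close> is left free so that all factorials of the Chebyshev combination can share one
  range of summation.\<close>

lemma ln_fact_eq_sum_mangoldt:
  assumes "n \<le> N"
  shows "ln (fact n) = (\<Sum>k=1..N. mangoldt k * real (n div k))"
  using assms
proof (induction n)
  case 0
  then show ?case by simp
next
  case (Suc n)
  \<comment> \<open>The quotient by \<open>k\<close> grows by one exactly when \<open>k\<close>
    divides \<open>Suc n\<close>, so the increment is the divisor sum of \<open>mangoldt\<close>,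
    which is \<open>ln (Suc n)\<close>.\<close>
  have "(\<Sum>k=1..N. mangoldt k * real (Suc n div k)) =
        (\<Sum>k=1..N. mangoldt k * real (n div k) + (if k dvd Suc n then mangoldt k else 0))"
    by (intro sum.cong) (auto simp: div_Suc dvd_eq_mod_eq_0 algebra_simps)
  also have "\<dots> = ln (fact n) + (\<Sum>k=1..N. if k dvd Suc n then mangoldt k else 0)"
    using Suc by (simp add: sum.distrib)
  also have "(\<Sum>k=1..N. if k dvd Suc n then mangoldt k else 0) =
             (\<Sum>k | k dvd Suc n. mangoldt k :: real)"
  proof (rule sum.mono_neutral_cong_right)
    show "{k. k dvd Suc n} \<subseteq> {1..N}"
    proof
      fix k assume "k \<in> {k. k dvd Suc n}"
      then have "k \<le> Suc n" "0 < k" by (auto intro: dvd_imp_le dvd_pos_nat[of "Suc n"])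
      then show "k \<in> {1..N}" using Suc.prems by simp
    qed
  qed auto
  also have "\<dots> = ln (real (Suc n))" using mangoldt_sum[of "Suc n", where ?'a = real] by simp
  finally show ?case by (simp add: ln_mult add.commute del: of_nat_Suc)
qed

section \<open>Chebyshev's bounds\<close>

definition chebyshev_psi :: "nat \<Rightarrow> real" where
  "chebyshev_psi n = (\<Sum>k=1..n. mangoldt k)"

definition chebyshev_comb :: "nat \<Rightarrow> real" where
  "chebyshev_comb n = ln (fact n) - ln (fact (n div 2)) - ln (fact (n div 3))
     - ln (fact (n div 5)) + ln (fact (n div 30))"

text \<open>The coefficient of \<open>n\<close> in the main term of \<open>chebyshev_comb n\<close>.
  Since 1 - 1/2 - 1/3 - 1/5 + 1/30 = 0, the terms of size \<open>n * ln n\<close> cancel and only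
  these remain.\<close>

definition chebyshev_const :: real where
  "chebyshev_const = ln 2 / 2 + ln 3 / 3 + ln 5 / 5 - ln 30 / 30"

text \<open>The coefficient of \<open>mangoldt k\<close> in \<open>chebyshev_comb n\<close> is this
  weight at \<open>t = n div k\<close>. It is integer-valued to avoid truncated subtraction.\<close>

definition chebyshev_weight :: "nat \<Rightarrow> int" where
  "chebyshev_weight t = int t - int (t div 2) - int (t div 3) - int (t div 5) + int (t div 30)"

text \<open>The weight has period 30 because 30 - 15 - 10 - 6 + 1 = 0, so the residues 0 to 29
  decide.\<close>

lemma chebyshev_weight_bounds: "0 \<le> chebyshev_weight t" "chebyshev_weight t \<le> 1"
proof -
  define r where "r = t mod 30"
  have t: "t = 30 * (t div 30) + r" and "r < 30" by (simp_all add: r_def)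
  have "t div 2 = 15 * (t div 30) + r div 2" by (subst t) presburger
  moreover have "t div 3 = 10 * (t div 30) + r div 3" by (subst t) presburger
  moreover have "t div 5 = 6 * (t div 30) + r div 5" by (subst t) presburger
  ultimately have w: "chebyshev_weight t = int r - int (r div 2) - int (r div 3) - int (r div 5)"
    using t by (simp add: chebyshev_weight_def)
  have "\<forall>r\<in>set [0..<30]. 0 \<le> int r - int (r div 2) - int (r div 3) - int (r div 5)
      \<and> int r - int (r div 2) - int (r div 3) - int (r div 5) \<le> 1"
    by code_simp
  then have "0 \<le> chebyshev_weight t \<and> chebyshev_weight t \<le> 1"
    unfolding w using \<open>r < 30\<close> by simp
  then show "0 \<le> chebyshev_weight t" "chebyshev_weight t \<le> 1" by auto
qed

text \<open>The weight first drops to 0 at \<open>t = 6\<close>; this is the origin of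
  \<open>n div 6\<close> below.\<close>

lemma chebyshev_weight_small:
  assumes "1 \<le> t" "t < 6"
  shows "chebyshev_weight t = 1"
proof -
  have "t = 1 \<or> t = 2 \<or> t = 3 \<or> t = 4 \<or> t = 5" using assms by linarith
  then show ?thesis by (auto simp: chebyshev_weight_def)
qed

lemma chebyshev_comb_eq_sum:
  "chebyshev_comb n = (\<Sum>k=1..n. mangoldt k * chebyshev_weight (n div k))"
proof -
  have div_swap: "n div d div k = n div k div d" for d k
    by (simp add: div_mult2_eq[symmetric] mult.commute)
  have T: "ln (fact (n div d)) = (\<Sum>k=1..n. mangoldt k * real (n div k div d))" for d
    by (subst ln_fact_eq_sum_mangoldt[of _ n]) (simp_all add: div_swap)
  show ?thesis
    unfolding chebyshev_comb_def T ln_fact_eq_sum_mangoldt[OF order_refl[of n]]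
    by (simp add: chebyshev_weight_def sum.distrib sum_subtractf algebra_simps)
qed

lemma chebyshev_comb_le_psi: "chebyshev_comb n \<le> chebyshev_psi n"
  unfolding chebyshev_comb_eq_sum chebyshev_psi_def
proof (rule sum_mono)
  fix k
  show "mangoldt k * real_of_int (chebyshev_weight (n div k)) \<le> mangoldt k"
    using mult_left_mono[of "real_of_int (chebyshev_weight (n div k))" 1 "mangoldt k"]
      chebyshev_weight_bounds(2)[of "n div k"] mangoldt_nonneg[of k] by simp
qed

text \<open>For \<open>n div 6 < k \<le> n\<close> the quotient \<open>n div k\<close> is between 1
  and 5, so the weight is exactly 1. The remaining terms of the combination are nonnegative.\<close>

lemma chebyshev_psi_diff_le_comb: "chebyshev_psi n - chebyshev_psi (n div 6) \<le> chebyshev_comb n"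
proof -
  have "chebyshev_psi n = chebyshev_psi (n div 6) + (\<Sum>k\<in>{n div 6<..n}. mangoldt k)"
    unfolding chebyshev_psi_def by (subst sum.union_disjoint[symmetric]) (auto intro!: sum.cong)
  also have "(\<Sum>k\<in>{n div 6<..n}. mangoldt k)
      = (\<Sum>k\<in>{n div 6<..n}. mangoldt k * real_of_int (chebyshev_weight (n div k)))"
  proof (rule sum.cong)
    fix k assume k: "k \<in> {n div 6<..n}"
    have "n < k * 6" using k by auto
    then have "n div k < 6" by (simp add: less_mult_imp_div_less mult.commute)
    moreover have "1 \<le> n div k" using k by (simp add: Suc_le_eq div_greater_zero_iff)
    ultimately show "mangoldt k = mangoldt k * real_of_int (chebyshev_weight (n div k))"
      using chebyshev_weight_small[of "n div k"] by simp
  qed simp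
  also have "\<dots> \<le> chebyshev_comb n"
    unfolding chebyshev_comb_eq_sum
    using chebyshev_weight_bounds(1)
    by (intro sum_mono2) (auto intro!: mult_nonneg_nonneg mangoldt_nonneg)
  finally show ?thesis by simp
qed

text \<open>Each of the five factorials contributes an error of at most \<open>1 + ln n\<close>. The
  -1 is the signed sum of the constants 1 in \<open>stirling_main\<close>.\<close>

lemma chebyshev_comb_approx:
  assumes "n \<ge> 1"
  shows "\<bar>chebyshev_comb n - (chebyshev_const * n - 1)\<bar> \<le> 5 + 5 * ln n"
proof -
  have "stirling_main n - stirling_main (n / 2) - stirling_main (n / 3) - stirling_main (n / 5)
      + stirling_main (n / 30) = chebyshev_const * n - 1"
    using assms by (simp add: stirling_main_def chebyshev_const_def ln_div algebra_simps)
  then show ?thesis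
    using ln_fact_div_approx[OF assms, of 1] ln_fact_div_approx[OF assms, of 2]
      ln_fact_div_approx[OF assms, of 3] ln_fact_div_approx[OF assms, of 5]
      ln_fact_div_approx[OF assms, of 30]
    unfolding chebyshev_comb_def by (simp add: abs_le_iff)
qed

section \<open>Rational bounds for logarithms\<close>

text \<open>Two consecutive convergents of the continued fraction of e, chosen for accuracy with
  small integers.\<close>

lemma exp_1_bounds: "106 / 39 < exp (1::real)" "exp (1::real) < 87 / 32"
  using e_approx_32 by (simp_all add: abs_if split: if_split_asm)

text \<open>With \<open>x = p / q\<close> the claim becomes \<open>exp 1 ^ p \<le> b ^ q\<close>.
  Bounding e by 87/32 leaves a comparison of natural numbers that can be evaluated.\<close>

lemma le_ln_of_power:
  fixes x :: real
  assumes "real q * x = real p" "(87::nat) ^ p \<le> 32 ^ p * b ^ q" "b > 0" "q > 0"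
  shows "x \<le> ln (real b)"
proof -
  have "exp x ^ q = exp 1 ^ p"
    using assms(1) by (simp add: exp_of_nat_mult[symmetric])
  also have "\<dots> \<le> (87 / 32) ^ p" using exp_1_bounds by (intro power_mono) auto
  also have "\<dots> \<le> real b ^ q"
  proof -
    have "real (87 ^ p) \<le> real (32 ^ p * b ^ q)" using assms(2) by (rule of_nat_mono)
    then show ?thesis by (simp add: power_divide field_simps)
  qed
  finally have "exp x \<le> b" using assms by (simp add: power_mono_iff)
  then show ?thesis using assms by (simp add: ln_ge_iff)
qed

lemma ln_le_of_power:
  fixes x :: real
  assumes "real q * x = real p" "39 ^ p * b ^ q \<le> (106::nat) ^ p" "b > 0" "q > 0"
  shows "ln (real b) \<le> x"
proof -
  have "real b ^ q \<le> (106 / 39) ^ p"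
  proof -
    have "real (39 ^ p * b ^ q) \<le> real (106 ^ p)" using assms(2) by (rule of_nat_mono)
    then show ?thesis by (simp add: power_divide field_simps)
  qed
  also have "(106 / 39 :: real) ^ p \<le> exp 1 ^ p" using exp_1_bounds by (intro power_mono) auto
  also have "\<dots> = exp x ^ q"
    using assms(1) by (simp add: exp_of_nat_mult[symmetric])
  finally have "b \<le> exp x" using assms by (simp add: power_mono_iff)
  then show ?thesis using assms(3) ln_le_cancel_iff[of "real b" "exp x"] by simp
qed

lemma chebyshev_const_bounds: "11 / 12 \<le> chebyshev_const" "chebyshev_const \<le> 83 / 90"
proof -
  \<comment> \<open>This integer is the exponential of \<open>30 * chebyshev_const\<close>: the
    exponents 15, 10, 6 each lose 1 to \<open>ln 30\<close>.\<close>
  have "ln (1007769600000 :: real) = ln (2 ^ 14 * 3 ^ 9 * 5 ^ 5)" by simp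
  also have "\<dots> = 14 * ln 2 + 9 * ln 3 + 5 * ln (5::real)"
    by (simp only: ln_mult_pos ln_realpow zero_less_power zero_less_numeral mult_pos_pos of_nat_numeral)
  finally have "ln (1007769600000 :: real) = 14 * ln 2 + 9 * ln 3 + 5 * ln (5::real)" .
  moreover have "ln (30::real) = ln 2 + ln 3 + ln 5"
    by (simp flip: ln_mult_pos)
  ultimately have c: "30 * chebyshev_const = ln 1007769600000"
    by (simp add: chebyshev_const_def add_divide_distrib algebra_simps)
  have "55 / 2 \<le> ln (real 1007769600000)"
    by (rule le_ln_of_power[of 2 _ 55]) simp_all
  then show "11 / 12 \<le> chebyshev_const" using c by simp
  have "ln (real 1007769600000) \<le> 83 / 3"
    by (rule ln_le_of_power[of 3 _ 83]) simp_all
  then show "chebyshev_const \<le> 83 / 90" using c by simp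
qed

lemma ln_6_bounds: "7 / 4 \<le> ln (6::real)" "ln (6::real) \<le> 9 / 5"
  using le_ln_of_power[of 4 "7 / 4" 7 6] ln_le_of_power[of 5 "9 / 5" 9 6] by simp_all

lemma chebyshev_psi_ge:
  assumes "n \<ge> 1"
  shows "11 / 12 * n - 6 - 5 * ln n \<le> chebyshev_psi n"
proof -
  have "11 / 12 * real n \<le> chebyshev_const * n"
    using chebyshev_const_bounds by (intro mult_right_mono) auto
  then show ?thesis
    using chebyshev_comb_approx[OF assms] chebyshev_comb_le_psi[of n] by linarith
qed

text \<open>Iterating the bound for \<psi>(n) - \<psi>(n/6) multiplies the linear coefficient by
  6/5, and 83/90 * 6/5 = 83/75. About \<open>ln n / ln 6\<close> rounds, each costing a multiple of
  \<open>ln n\<close>, produce the squared logarithm.\<close>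

lemma chebyshev_psi_le:
  assumes "n \<ge> 1"
  shows "chebyshev_psi n \<le> 83 / 75 * n + 3 / 2 * (ln n)\<^sup>2 + 6 * ln n + 4"
  using assms
proof (induction n rule: less_induct)
  case (less n)
  define L where "L = ln (real n)"
  have L: "0 \<le> L" using less.prems by (simp add: L_def del: set_upt)
  have "chebyshev_const * real n \<le> 83 / 90 * n"
    using chebyshev_const_bounds by (intro mult_right_mono) auto
  then have step: "chebyshev_psi n \<le> 83 / 90 * n + 4 + 5 * L + chebyshev_psi (n div 6)"
    using chebyshev_comb_approx[OF less.prems] chebyshev_psi_diff_le_comb[of n]
    unfolding L_def by linarith
  show ?case
  proof (cases "n < 6")
    case True
    then have "chebyshev_psi (n div 6) = 0" by (simp add: chebyshev_psi_def)
    moreover have "0 \<le> L\<^sup>2" "0 \<le> real n" by simp_all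
    ultimately show ?thesis using step L unfolding L_def[symmetric] by linarith
  next
    case False
    define m where "m = n div 6"
    have m: "1 \<le> m" "m < n" "6 * m \<le> n" using False by (auto simp: m_def)
    have M: "0 \<le> ln (real m)" "ln (real m) \<le> L - ln 6"
    proof -
      have "ln (real m) \<le> ln (real n / 6)" using m by (subst ln_le_cancel_iff) auto
      then show "ln (real m) \<le> L - ln 6" using m by (simp add: ln_div L_def)
    qed (use m in simp)
    have "(ln (real m))\<^sup>2 \<le> (L - ln 6)\<^sup>2" using M by (intro power_mono)
    also have "(L - ln 6)\<^sup>2 = L\<^sup>2 - 2 * (L * ln 6) + (ln 6)\<^sup>2"
      by (simp add: power2_diff)
    also have "\<dots> \<le> L\<^sup>2 - 2 * (L * (7 / 4)) + (9 / 5)\<^sup>2"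
    proof -
      have "L * (7 / 4) \<le> L * ln 6" using ln_6_bounds L by (intro mult_left_mono) auto
      moreover have "(ln 6)\<^sup>2 \<le> (9 / 5 :: real)\<^sup>2" using ln_6_bounds by (intro power_mono) auto
      ultimately show ?thesis by linarith
    qed
    finally have sq: "(ln (real m))\<^sup>2 \<le> L\<^sup>2 - 7 / 2 * L + 81 / 25" by (simp add: power2_eq_square)
    have "chebyshev_psi m \<le> 83 / 75 * m + 3 / 2 * (ln m)\<^sup>2 + 6 * ln m + 4"
      using less.IH m by simp
    moreover have "6 * real m \<le> n" using m(3) by linarith
    \<comment> \<open>The linear terms balance, as 83/90 + 83/450 = 83/75. The square yields -21/4 *
      \<open>L\<close>, which absorbs the new 5 * \<open>L\<close>.\<close>
    ultimately show ?thesis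
      using step sq M ln_6_bounds L unfolding m_def[symmetric] L_def[symmetric] by simp
  qed
qed

section \<open>Two primes in an interval\<close>

text \<open>Successive powers grow by a factor of at least 2, so the power after one above
  \<open>x\<close> exceeds \<open>2 * x\<close>.\<close>

lemma prime_power_in_octave_unique:
  fixes p x :: nat
  assumes "p \<ge> 2" "x < p ^ i" "p ^ i \<le> 2 * x" "x < p ^ j" "p ^ j \<le> 2 * x"
  shows "i = j"
proof -
  have *: "\<not> i < j" if "x < p ^ i" "p ^ j \<le> 2 * x" for i j
  proof
    assume "i < j"
    then have "p ^ Suc i \<le> p ^ j" using assms(1) by (intro power_increasing) auto
    moreover have "2 * p ^ i \<le> p ^ Suc i" using assms(1) by simp
    ultimately show False using that by linarith
  qed
  show ?thesis using *[of i j] *[of j i] assms by linarith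
qed

text \<open>A prime power with exponent at least 2 has its base at most \<open>sqrt m\<close>. By
  uniqueness in \<open>(x, 2 * x]\<close> the bases are distinct, so there are at most
  \<open>sqrt m\<close> terms, each at most \<open>ln (sqrt m)\<close>.\<close>

lemma sum_mangoldt_nonprime_le:
  fixes m x :: nat
  assumes "m \<le> 2 * x" "m \<ge> 1"
  shows "(\<Sum>k\<in>{k\<in>{x<..m}. \<not> prime k}. mangoldt k) \<le> sqrt m * (ln m / 2)"
proof -
  define S where "S = {k\<in>{x<..m}. primepow k \<and> \<not> prime k}"
  have fin: "finite S" by (simp add: S_def)
  have S: "\<exists>i\<ge>2. prime (aprimedivisor k) \<and> k = aprimedivisor k ^ i" if "k \<in> S" for k
  proof -
    from that obtain p i where p: "prime p" "i > 0" "k = p ^ i"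
      by (auto simp: S_def primepow_def)
    then have "aprimedivisor k = p" by (simp add: aprimedivisor_prime_power)
    moreover have "i \<noteq> 1" using that p by (auto simp: S_def)
    ultimately show ?thesis using p by (intro exI[of _ i]) auto
  qed
  have ap: "2 \<le> aprimedivisor k" "(aprimedivisor k)\<^sup>2 \<le> m" if k: "k \<in> S" for k
  proof -
    from S[OF k] obtain i where i: "i \<ge> 2" "prime (aprimedivisor k)" "k = aprimedivisor k ^ i"
      by blast
    show p2: "2 \<le> aprimedivisor k" using i by (simp add: prime_ge_2_nat)
    have "(aprimedivisor k)\<^sup>2 \<le> aprimedivisor k ^ i" using i p2 by (intro power_increasing) auto
    also have "\<dots> \<le> m" using i(3) k by (simp add: S_def)
    finally show "(aprimedivisor k)\<^sup>2 \<le> m" .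
  qed
  have ap_sqrt: "real (aprimedivisor k) \<le> sqrt m" if "k \<in> S" for k
    using ap(2)[OF that] by (intro real_le_rsqrt) (metis of_nat_le_iff of_nat_power)
  have "inj_on aprimedivisor S"
  proof (rule inj_onI)
    fix k l assume k: "k \<in> S" and l: "l \<in> S" and eq: "aprimedivisor k = aprimedivisor l"
    from S[OF k] obtain i where i: "k = aprimedivisor k ^ i" by blast
    from S[OF l] obtain j where j: "l = aprimedivisor k ^ j" using eq by metis
    have "x < aprimedivisor k ^ i" "aprimedivisor k ^ i \<le> 2 * x"
      using k assms(1) i[symmetric] by (auto simp: S_def)
    moreover have "x < aprimedivisor k ^ j" "aprimedivisor k ^ j \<le> 2 * x"
      using l assms(1) j[symmetric] by (auto simp: S_def)
    ultimately have "i = j" using prime_power_in_octave_unique ap(1)[OF k] by blast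
    then show "k = l" using i j by metis
  qed
  moreover have "aprimedivisor ` S \<subseteq> {1..nat \<lfloor>sqrt m\<rfloor>}"
  proof
    fix p assume "p \<in> aprimedivisor ` S"
    then obtain k where k: "k \<in> S" "p = aprimedivisor k" by blast
    show "p \<in> {1..nat \<lfloor>sqrt m\<rfloor>}"
      using ap(1)[OF k(1)] ap_sqrt[OF k(1)] k(2) by (auto simp: le_nat_floor)
  qed
  ultimately have "card S \<le> nat \<lfloor>sqrt m\<rfloor>"
    using card_mono[of "{1..nat \<lfloor>sqrt m\<rfloor>}" "aprimedivisor ` S"] by (simp add: card_image)
  also have "real (nat \<lfloor>sqrt m\<rfloor>) \<le> sqrt m" by (simp add: of_nat_floor)
  finally have card: "real (card S) \<le> sqrt m" by simp
  have "(\<Sum>k\<in>{k\<in>{x<..m}. \<not> prime k}. mangoldt k) = (\<Sum>k\<in>S. mangoldt k :: real)"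
    by (rule sum.mono_neutral_right) (auto simp: S_def mangoldt_def)
  also have "\<dots> \<le> (\<Sum>k\<in>S. ln m / 2)"
  proof (rule sum_mono)
    fix k assume k: "k \<in> S"
    have "mangoldt k = ln (real (aprimedivisor k))" using k by (simp add: S_def mangoldt_def)
    also have "\<dots> \<le> ln (sqrt m)" using ap_sqrt[OF k] ap(1)[OF k] assms by (subst ln_le_cancel_iff) auto
    also have "\<dots> = ln m / 2" using assms by (simp add: ln_sqrt)
    finally show "mangoldt k \<le> ln m / 2" .
  qed
  also have "\<dots> = real (card S) * (ln m / 2)" by simp
  also have "\<dots> \<le> sqrt m * (ln m / 2)" using card assms by (intro mult_right_mono) auto
  finally show ?thesis .
qed

lemma chebyshev_psi_diff_le_if_few_primes:
  assumes "x \<le> m" "m \<le> 2 * x" "m \<ge> 1" "card {p\<in>{x<..m}. prime p} \<le> 1"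
  shows "chebyshev_psi m - chebyshev_psi x \<le> ln m + sqrt m * (ln m / 2)"
proof -
  have "chebyshev_psi m - chebyshev_psi x = (\<Sum>k\<in>{x<..m}. mangoldt k)"
    unfolding chebyshev_psi_def using assms(1)
    by (subst sum_diff[symmetric]) (auto intro!: sum.cong)
  also have "\<dots> = (\<Sum>k\<in>{k\<in>{x<..m}. prime k}. mangoldt k) + (\<Sum>k\<in>{k\<in>{x<..m}. \<not> prime k}. mangoldt k)"
    by (subst sum.union_disjoint[symmetric]) (auto intro!: sum.cong)
  also have "(\<Sum>k\<in>{k\<in>{x<..m}. prime k}. mangoldt k) \<le> (\<Sum>k\<in>{k\<in>{x<..m}. prime k}. ln m)"
    by (rule sum_mono) (auto simp: prime_gt_0_nat)
  also have "\<dots> \<le> 1 * ln m"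
    using assms by (simp only: sum_constant, intro mult_right_mono) auto
  finally show ?thesis using sum_mangoldt_nonprime_le[OF assms(2,3)] by simp
qed

text \<open>The inequality for \<open>y = x\<^bsup>1/4\<^esup>\<close>, with \<open>ln x\<close> replaced by its tangent bound at \<open>y = 8\<close>.\<close>

lemma quartic_dominates:
  fixes y :: real
  assumes "y \<ge> 8"
  shows "3 / 5 * y^2 * (y / 2 + 24 / 5) + 3 / 2 * (y / 2 + 22 / 5)\<^sup>2 + 12 * (y / 2 + 24 / 5) + 54 / 5
    < 53 / 300 * y ^ 4"
proof -
  \<comment> \<open>Expanded around 8, the difference of the two sides has only positive
    coefficients.\<close>
  define z where "z = y - 8"
  have y: "y = z + 8" and z: "z \<ge> 0" using assms by (simp_all add: z_def)
  have "53 / 300 * y ^ 4 - (3 / 5 * y^2 * (y / 2 + 24 / 5) + 3 / 2 * (y / 2 + 22 / 5)\<^sup>2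
      + 12 * (y / 2 + 24 / 5) + 54 / 5)
    = 53 / 300 * z ^ 4 + 803 / 150 * z ^ 3 + 11477 / 200 * z^2 + 3593 / 15 * z + 2452 / 15"
    unfolding y by (simp add: field_simps power4_eq_xxxx power3_eq_cube power2_eq_square)
  also have "\<dots> > 0" using z by (intro add_nonneg_pos add_nonneg_nonneg) auto
  finally show ?thesis by simp
qed

text \<open>With at most one prime, \<psi> would grow only by about
  \<open>sqrt m * ln m / 2\<close>, while the Chebyshev bounds force linear growth. The threshold is
  4096 = \<open>8 ^ 4\<close>, matching \<open>y \<ge> 8\<close> for the fourth root
  \<open>y\<close> of \<open>x\<close>.\<close>

lemma two_primes_large:
  fixes x :: nat
  assumes "x \<ge> 4096"
  shows "card {p\<in>{x<..7 * x div 5}. prime p} \<ge> 2"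
proof (rule ccontr)
  assume "\<not> ?thesis"
  then have few: "card {p\<in>{x<..7 * x div 5}. prime p} \<le> 1" by linarith
  define m where "m = 7 * x div 5"
  have m: "x \<le> m" "m \<le> 2 * x" "m \<ge> 1" "5 * m \<le> 7 * x" "7 * x \<le> 5 * m + 4"
    using assms by (auto simp: m_def)
  define y where "y = root 4 x"
  have y4: "y ^ 4 = x" by (simp add: y_def)
  have "root 4 (8 ^ 4) \<le> y" unfolding y_def using assms by (subst real_root_le_iff) auto
  then have y: "y \<ge> 8" by (simp add: real_root_power_cancel)
  have ln8: "ln (8::real) \<le> 21 / 10"
    using ln_le_of_power[of 10 "21 / 10" 21 8] by simp
  have "ln (y / 8) \<le> y / 8 - 1" using y by (intro ln_le_minus_one) auto
  then have "ln y \<le> y / 8 + 11 / 10" using ln8 y by (simp add: ln_div)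
  moreover have "ln (real x) = 4 * ln y" unfolding y4[symmetric] using y by (simp add: ln_realpow)
  ultimately have L: "ln (real x) \<le> y / 2 + 22 / 5" by simp
  have L0: "0 \<le> ln (real x)" using assms by simp
  have "ln (real m) \<le> ln (7 / 5 * real x)" using m by (subst ln_le_cancel_iff) auto
  also have "\<dots> = ln (7 / 5) + ln (real x)" using m by (subst ln_mult) auto
  also have "ln (7 / 5 :: real) \<le> 2 / 5" using ln_le_minus_one[of "7 / 5::real"] by simp
  finally have M: "ln (real m) \<le> y / 2 + 24 / 5" using L by simp
  \<comment> \<open>It is enough that 7/5 < 36/25.\<close>
  have "sqrt m \<le> 6 / 5 * y^2"
  proof (rule real_le_lsqrt)
    have "(6 / 5 * y^2)^2 = 36 / 25 * y ^ 4" by (simp add: power_mult_distrib power_divide flip: power_mult)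
    then show "real m \<le> (6 / 5 * y^2)^2" using m y4 by simp
  qed simp
  then have sq: "sqrt m * (ln m / 2) \<le> 6 / 5 * y^2 * ((y / 2 + 24 / 5) / 2)"
    using M m by (intro mult_mono) auto
  have L2: "(ln (real x))\<^sup>2 \<le> (y / 2 + 22 / 5)\<^sup>2" using L L0 by (intro power_mono)
  have psi: "chebyshev_psi m - chebyshev_psi x \<le> ln m + sqrt m * (ln m / 2)"
    using chebyshev_psi_diff_le_if_few_primes[OF m(1-3)] few by (simp add: m_def)
  have "real x \<ge> 1" "7 * real x \<le> 5 * real m + 4" using m assms by auto
  \<comment> \<open>The coefficient is 11/12 * 7/5 - 83/75 = 53/300. The twelve logarithms are 5 + 1
    of \<open>m\<close> and 6 of \<open>x\<close>; 54/5 covers 6 + 4 and the loss of 11/15 from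
    rounding \<open>m\<close> down.\<close>
  then have "53 / 300 * y ^ 4 \<le> 3 / 5 * y^2 * (y / 2 + 24 / 5) + 3 / 2 * (y / 2 + 22 / 5)\<^sup>2
      + 12 * (y / 2 + 24 / 5) + 54 / 5"
    using psi sq L2 L M chebyshev_psi_ge[OF m(3)] chebyshev_psi_le[of x] assms
    unfolding y4 by simp
  then show False using quartic_dominates[OF y] by linarith
qed

section \<open>Explicit primes below 4096\<close>

lemma prime_if_no_divisor_below_sqrt:
  fixes n s :: nat
  assumes "1 < n" "n < s * s" "\<forall>d\<in>set [2..<s]. \<not> d dvd n"
  shows "prime n"
proof (rule ccontr)
  assume "\<not> prime n"
  then obtain a where "a dvd n" "a \<noteq> 1" "a \<noteq> n"
    using assms(1) by (auto simp: prime_nat_iff)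
  then obtain b where ab: "n = a * b" "a \<noteq> 1" "b \<noteq> 1" by auto
  then have "1 < a" "1 < b" using assms(1) by (cases a; cases b; auto)+
  have "\<not> (s \<le> a \<and> s \<le> b)" using assms(2) ab mult_le_mono[of s a s b] by linarith
  then have "a \<in> set [2..<s] \<or> b \<in> set [2..<s]"
    using \<open>1 < a\<close> \<open>1 < b\<close> by auto
  then show False using assms(3) ab(1) by (metis dvd_triv_left dvd_triv_right)
qed

text \<open>The number \<open>l\<close> is the start of the range still to be covered. The pair
  \<open>(a, b)\<close> serves every \<open>x\<close> with \<open>l \<le> x < a\<close>, for which
  \<open>5 * b \<le> 7 * l\<close> is the worst case, and the next pair takes over at
  \<open>a\<close>.\<close>

fun prime_chain :: "nat \<Rightarrow> (nat \<times> nat) list \<Rightarrow> bool" where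
  "prime_chain l [] \<longleftrightarrow> True"
| "prime_chain l ((a, b) # xs) \<longleftrightarrow>
     prime a \<and> prime b \<and> a < b \<and> 5 * b \<le> 7 * l \<and> prime_chain a xs"

lemma two_primes_of_chain:
  assumes "prime_chain l xs" "l \<le> x" "x < last (l # map fst xs)"
  shows "\<exists>a b. prime a \<and> prime b \<and> x < a \<and> a < b \<and> 5 * b \<le> 7 * x"
  using assms
proof (induction l xs rule: prime_chain.induct)
  case (1 l)
  then show ?case by simp
next
  case (2 l a b xs)
  show ?case
  proof (cases "x < a")
    case True
    then show ?thesis using 2 by (intro exI[of _ a] exI[of _ b]) auto
  next
    case False
    then show ?thesis using 2 by simp
  qed
qed

lemma two_primes_small:
  fixes x :: nat
  assumes "23 \<le> x" "x < 4096"
  shows "\<exists>a b. prime a \<and> prime b \<and> x < a \<and> a < b \<and> 5 * b \<le> 7 * x"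
proof -
  \<comment> \<open>Each prime carries a limit for trial division, whose square exceeds the
    prime.\<close>
  define L :: "(nat \<times> nat) list" where
    "L = [(29, 6), (31, 6), (37, 7), (41, 7), (43, 7), (47, 7), (53, 8), (59, 8), (61, 8), (73, 9),
      (79, 9), (97, 10), (101, 11), (127, 12), (131, 12), (167, 13), (173, 14), (229, 16),
      (233, 16), (313, 18), (317, 18), (431, 21), (433, 21), (599, 25), (601, 25), (827, 29),
      (829, 29), (1151, 34), (1153, 34), (1607, 41), (1609, 41), (2239, 48), (2243, 48),
      (3119, 56), (3121, 56), (4357, 67), (4363, 67)]"
  have "\<forall>(p, s)\<in>set L. 1 < p \<and> p < s * s \<and> (\<forall>d\<in>set [2..<s]. \<not> d dvd p)"
    by (simp add: L_def del: set_upt)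
  then have primes: "prime p" if "p \<in> fst ` set L" for p
    using that prime_if_no_divisor_below_sqrt by fastforce
  have "prime_chain 23 [(29, 31), (31, 37), (41, 43), (47, 53), (59, 61), (73, 79), (97, 101), (127, 131),
      (167, 173), (229, 233), (313, 317), (431, 433), (599, 601), (827, 829), (1151, 1153),
      (1607, 1609), (2239, 2243), (3119, 3121), (4357, 4363)]"
    by (simp add: primes L_def del: prime_nat_numeral_eq)
  from two_primes_of_chain[OF this assms(1)] show ?thesis using assms(2) by simp
qed

lemma two_primes:
  fixes x :: nat
  assumes "23 \<le> x"
  shows "\<exists>a b. prime a \<and> prime b \<and> x < a \<and> a < b \<and> 5 * b \<le> 7 * x"
proof (cases "x < 4096")
  case True
  then show ?thesis using two_primes_small assms by blast
next
  case False
  then have "\<not> card {p\<in>{x<..7 * x div 5}. prime p} \<le> Suc 0"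
    using two_primes_large[of x] by linarith
  then obtain a b where ab: "a \<noteq> b" "a \<in> {p\<in>{x<..7 * x div 5}. prime p}"
      "b \<in> {p\<in>{x<..7 * x div 5}. prime p}"
    by (subst (asm) card_le_Suc0_iff_eq) auto
  then have "prime (min a b) \<and> prime (max a b) \<and> x < min a b \<and> min a b < max a b
      \<and> 5 * max a b \<le> 7 * x"
    by (auto simp: min_def max_def)
  then show ?thesis by blast
qed

section \<open>Consecutive primes\<close>

lemma prime_nth_prime: "prime (nth_prime n)"
  using enumerate_in_set[OF primes_infinite, of "n - 1"] by (simp add: nth_prime_def)

lemma nth_prime_less_Suc: "n \<ge> 1 \<Longrightarrow> nth_prime n < nth_prime (Suc n)"
  using LeastI_ex[OF bigger_prime[of "nth_prime n"]] by (simp add: nth_prime_Suc)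

lemma nth_prime_Suc_le:
  assumes "n \<ge> 1" "prime q" "nth_prime n < q"
  shows "nth_prime (Suc n) \<le> q"
  using assms by (simp add: nth_prime_Suc Least_le)

lemma nth_prime_ge_7:
  assumes "n \<ge> 4"
  shows "nth_prime n \<ge> 7"
  using assms
proof (induction n rule: dec_induct)
  case base
  have "nth_prime 1 < nth_prime 2" "nth_prime 2 < nth_prime 3" "nth_prime 3 < nth_prime 4"
    using nth_prime_less_Suc[of 1] nth_prime_less_Suc[of 2] nth_prime_less_Suc[of 3]
    by (simp_all add: eval_nat_numeral)
  \<comment> \<open>Strict growth from 2 alone gives only 4 and then 6 as lower bounds; primality
    improves them to 5 and 7.\<close>
  moreover have "nth_prime 3 \<noteq> 4" "nth_prime 4 \<noteq> 6"
    using prime_nth_prime[of 3] prime_nth_prime[of 4] by (auto simp del: One_nat_def)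
  ultimately show ?case using nth_prime_1 by linarith
next
  case (step n)
  then show ?case using nth_prime_less_Suc[of n] by linarith
qed

theorem theorem2:
  fixes n :: nat
  assumes "n \<ge> 4"
  shows "(nth_prime (n + 2))\<^sup>2 < (nth_prime (n + 1))\<^sup>2 + (nth_prime n)\<^sup>2"
proof -
  define p q r where "p = nth_prime n" and "q = nth_prime (n + 1)" and "r = nth_prime (n + 2)"
  have p: "prime p" "7 \<le> p" and q: "prime q" "p < q"
    using prime_nth_prime nth_prime_ge_7[OF assms] nth_prime_less_Suc[of n] assms
    by (simp_all add: p_def q_def)
  \<comment> \<open>Any two primes above \<open>p\<close> bound the second prime after it, so
    existence of two primes suffices.\<close>
  have r: "r \<le> b" if "prime a" "prime b" "p < a" "a < b" for a b
    using that nth_prime_Suc_le[of n a] nth_prime_Suc_le[of "n + 1" b] assms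
    by (simp add: p_def q_def r_def)
  have "r\<^sup>2 < q\<^sup>2 + p\<^sup>2"
  proof (cases "p < 23")
    case False
    then obtain a b where ab: "prime a" "prime b" "p < a" "a < b" "5 * b \<le> 7 * p"
      using two_primes[of p] by auto
    have "5 * r \<le> 7 * p" using r[OF ab(1-4)] ab(5) by linarith
    \<comment> \<open>Since 49 < 2 * 25, this gives \<open>r\<^sup>2 < 2 * p\<^sup>2\<close>, and
      \<open>p < q\<close>.\<close>
    then have "(5 * r)\<^sup>2 \<le> (7 * p)\<^sup>2" by (intro power_mono) auto
    moreover have "p\<^sup>2 < q\<^sup>2" "0 < p\<^sup>2" using q p by (auto intro: power_strict_mono)
    ultimately show ?thesis by (simp add: power_mult_distrib)
  next
    case True
    \<comment> \<open>The ratio 7/5 fails at 19, where 5 * 29 > 7 * 19, so primes below 23 are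
      treated singly: \<open>b\<close> bounds \<open>q\<close> from below and \<open>c\<close>
      bounds \<open>r\<close> from above. At 7 and 11 the margin is only 1.\<close>
    have small: ?thesis if "\<forall>k\<in>set [Suc p..<b]. \<not> prime k"
      "prime b" "prime c" "p < b" "b < c" "c\<^sup>2 < b\<^sup>2 + p\<^sup>2" for b c
    proof -
      have "q \<notin> set [Suc p..<b]" using that(1) q by blast
      then have "b \<le> q" using q by simp
      moreover have "r \<le> c" using r that by blast
      ultimately show ?thesis
        using that(6) power_mono[of b q 2] power_mono[of r c 2] by linarith
    qed
    have "p \<in> set [7..<23]" using True p(2) by (simp only: set_upt atLeastLessThan_iff)
    then have "p = 7 \<or> p = 11 \<or> p = 13 \<or> p = 17 \<or> p = 19"
      using p(1) by (auto simp del: set_upt)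
    then show ?thesis
    proof (elim disjE)
      assume "p = 7"
      then show ?thesis by (intro small[of 11 13]) (simp_all del: set_upt)
    next
      assume "p = 11"
      then show ?thesis by (intro small[of 13 17]) (simp_all del: set_upt)
    next
      assume "p = 13"
      then show ?thesis by (intro small[of 17 19]) (simp_all del: set_upt)
    next
      assume "p = 17"
      then show ?thesis by (intro small[of 19 23]) (simp_all del: set_upt)
    next
      assume "p = 19"
      then show ?thesis by (intro small[of 23 29]) (simp_all del: set_upt)
    qed
  qed
  then show ?thesis by (simp add: p_def q_def r_def)
qed

end
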